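(* There exists an absolute constant $c_2$ such that for every $n \in \mathbb{N}$ there exists a graph $G \in \mathcal{G}_{\mathrm{seg}}$ on $n$ vertices with \[ \alpha(G) \le \frac{n}{4} + c_2\sqrt{n}. \]
   Context: $\mathcal{G}_{\mathrm{seg}}$ denotes the class of graphs that are intersection graphs of finite families of axis-parallel (horizontal or vertical) segments in the plane in which no three segments have a common point. The intersection graph of a family of segments has the segments as vertices, two being adjacent if and only if they intersect. $\alpha(G)$ denotes the maximum size of an independent set in $G$. *)

theory Defs
  imports "HOL-Analysis.Analysis" "Graph_Theory.Pair_Digraph"
begin

text \<open>Finite simple graphs are symmetric, loop-free digraphs (locale \<open>pair_graph\<close>).
  The intersection graph of a finite family is one of these.\<close>

definition intersection_graph :: "'a set set \<Rightarrow> 'a set pair_pre_digraph" where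
  "intersection_graph S =
     \<lparr>pverts = S, parcs = {(A, B). A \<in> S \<and> B \<in> S \<and> A \<noteq> B \<and> A \<inter> B \<noteq> {}}\<rparr>"

lemma pair_graph_intersection_graph:
  assumes "finite S"
  shows "pair_graph (intersection_graph S)"
proof -
  have "finite {(A, B). A \<in> S \<and> B \<in> S \<and> A \<noteq> B \<and> A \<inter> B \<noteq> {}}"
    by (rule finite_subset[of _ "S \<times> S"]) (use assms in auto)
  then show ?thesis
    by unfold_locales
      (use assms in \<open>auto simp: intersection_graph_def symmetric_def arcs_ends_conv intro!: symI\<close>)
qed

definition independent_set :: "'v pair_pre_digraph \<Rightarrow> 'v set \<Rightarrow> bool" where
  "independent_set G I \<longleftrightarrow> I \<subseteq> pverts G \<and> (\<forall>u\<in>I. \<forall>v\<in>I. (u, v) \<notin> parcs G)"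

text \<open>Meaningful for finite \<open>G\<close>: the maximum is then over a finite set,
  nonempty because the empty set is independent.\<close>

definition independence_number :: "'v pair_pre_digraph \<Rightarrow> nat" (\<open>\<alpha>\<close>) where
  "\<alpha> G = Max {card I | I. independent_set G I}"

text \<open>Segments are closed and non-degenerate.\<close>

definition horizontal_segment :: "(real \<times> real) set \<Rightarrow> bool" where
  "horizontal_segment A \<longleftrightarrow> (\<exists>a b. a \<noteq> b \<and> snd a = snd b \<and> A = closed_segment a b)"

definition vertical_segment :: "(real \<times> real) set \<Rightarrow> bool" where
  "vertical_segment A \<longleftrightarrow> (\<exists>a b. a \<noteq> b \<and> fst a = fst b \<and> A = closed_segment a b)"

text \<open>The vertices of a member of \<open>\<G>\<^sub>s\<^sub>e\<^sub>g\<close> are the segments themselves. Parallel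
  segments may overlap; only triple intersections are excluded.\<close>

definition G_seg :: "(real \<times> real) set pair_pre_digraph set" (\<open>\<G>\<^sub>s\<^sub>e\<^sub>g\<close>) where
  "\<G>\<^sub>s\<^sub>e\<^sub>g = {intersection_graph S | S.
     finite S \<and>
     (\<forall>A\<in>S. horizontal_segment A \<or> vertical_segment A) \<and>
     (\<forall>A\<in>S. \<forall>B\<in>S. \<forall>C\<in>S. A \<noteq> B \<and> A \<noteq> C \<and> B \<noteq> C \<longrightarrow> A \<inter> B \<inter> C = {})}"

end

theory Submission
  imports Defs
begin

text \<open>Take a \<open>K \<times> K\<close> array of cells. Each cell owns a private horizontal line and a private
  vertical line, each covered by two segments that overlap only in a short interval inside the cell,
  away from all lines of the other direction. This gives \<open>n = 4 K\<^sup>2\<close> segments. An independent set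
  contains at most one segment of each line, so it has at most \<open>K\<^sup>2 + m\<close> elements, where \<open>m\<close> counts
  the cells contributing both a horizontal and a vertical segment. Classify these cells by the
  directions of their two segments. If a cell contributes its right segment and another one its upper segment, these
  two cross as soon as the second cell is to the right of and below the first one; so the cells
  of one class form a monotone chain of length at most \<open>2 K\<close>, whence \<open>m \<le> 8 K\<close>. Other values
  of \<open>n\<close> follow by discarding segments.\<close>

section \<open>Segments of the array\<close>

text \<open>\<open>True\<close> is the right or upper segment of a line, \<open>False\<close> the
  left or lower one. Both contain \<open>i * K - 1/2\<close> and share only a stretch strictly
  between two integers. The outer ends \<open>-1\<close> and \<open>K * K\<close> lie beyond all
  line coordinates, which run from \<open>0\<close> to \<open>K * K - 1\<close>; \<open>-1\<close>
  also keeps the piece for \<open>i = 0\<close> non-degenerate.\<close>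

definition span_ivl :: "nat \<Rightarrow> bool \<Rightarrow> nat \<Rightarrow> real set" where
  "span_ivl K s i = (if s then {real (i * K) - 2/3 .. real (K * K)} else {-1 .. real (i * K) - 1/3})"

text \<open>Lines come in blocks of \<open>K\<close>, one block per row of cells; the column index
  is the position within the block, so no two cells share a line.\<close>

definition hseg :: "nat \<Rightarrow> bool \<Rightarrow> nat \<times> nat \<Rightarrow> (real \<times> real) set" where
  "hseg K s c = span_ivl K s (fst c) \<times> {real (snd c * K + fst c)}"

definition vseg :: "nat \<Rightarrow> bool \<Rightarrow> nat \<times> nat \<Rightarrow> (real \<times> real) set" where
  "vseg K s c = {real (fst c * K + snd c)} \<times> span_ivl K s (snd c)"

definition cells :: "nat \<Rightarrow> (nat \<times> nat) set" where
  "cells K = {..<K} \<times> {..<K}"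

definition hsegs :: "nat \<Rightarrow> (real \<times> real) set set" where
  "hsegs K = (\<lambda>(s, c). hseg K s c) ` (UNIV \<times> cells K)"

definition vsegs :: "nat \<Rightarrow> (real \<times> real) set set" where
  "vsegs K = (\<lambda>(s, c). vseg K s c) ` (UNIV \<times> cells K)"

lemma closed_segment_Pair_same_snd:
  fixes a b y :: real
  assumes "a \<le> b"
  shows "closed_segment (a, y) (b, y) = {a..b} \<times> {y}"
proof -
  have "closed_segment (a, y) (b, y) = (\<lambda>x. (x, y)) ` closed_segment a b"
    unfolding closed_segment_image_interval image_image
    by (intro image_cong) (auto simp: algebra_simps)
  then show ?thesis
    using assms by (auto simp: closed_segment_eq_real_ivl)
qed

lemma closed_segment_Pair_same_fst:
  fixes a b x :: real
  assumes "a \<le> b"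
  shows "closed_segment (x, a) (x, b) = {x} \<times> {a..b}"
proof -
  have "closed_segment (x, a) (x, b) = Pair x ` closed_segment a b"
    unfolding closed_segment_image_interval image_image
    by (intro image_cong) (auto simp: algebra_simps)
  then show ?thesis
    using assms by (auto simp: closed_segment_eq_real_ivl)
qed

lemma span_ivl_eq:
  assumes "i < K"
  shows "\<exists>u v. u < v \<and> span_ivl K s i = {u..v}"
proof -
  have "real (i * K) \<le> real (K * K)"
    using assms by (intro of_nat_mono mult_right_mono) auto
  then have "real (i * K) - 2/3 < real (K * K)" "- 1 < real (i * K) - 1/3"
    by (linarith, simp add: add_strict_increasing2 del: of_nat_mult)
  then show ?thesis
    unfolding span_ivl_def by (metis (full_types))
qed

lemma horizontal_segment_hseg:
  assumes "c \<in> cells K"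
  shows "horizontal_segment (hseg K s c)"
proof -
  obtain u v where uv: "u < v" "span_ivl K s (fst c) = {u..v}"
    using assms span_ivl_eq[of "fst c" K s] by (auto simp: cells_def)
  then have "hseg K s c = closed_segment (u, real (snd c * K + fst c)) (v, real (snd c * K + fst c))"
    by (simp add: hseg_def closed_segment_Pair_same_snd del: of_nat_add of_nat_mult)
  then show ?thesis
    using uv(1) unfolding horizontal_segment_def
    by (metis fst_conv less_irrefl snd_conv)
qed

lemma vertical_segment_vseg:
  assumes "c \<in> cells K"
  shows "vertical_segment (vseg K s c)"
proof -
  obtain u v where uv: "u < v" "span_ivl K s (snd c) = {u..v}"
    using assms span_ivl_eq[of "snd c" K s] by (auto simp: cells_def)
  then have "vseg K s c = closed_segment (real (fst c * K + snd c), u) (real (fst c * K + snd c), v)"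
    by (simp add: vseg_def closed_segment_Pair_same_fst del: of_nat_add of_nat_mult)
  then show ?thesis
    using uv(1) unfolding vertical_segment_def
    by (metis fst_conv less_irrefl snd_conv)
qed

section \<open>Line coordinates and half-line intervals\<close>

lemma mult_add_eq_mult_add_iff:
  fixes a a' b b' K :: nat
  assumes "a < K" "a' < K"
  shows "b * K + a = b' * K + a' \<longleftrightarrow> a = a' \<and> b = b'"
proof
  assume eq: "b * K + a = b' * K + a'"
  have "(b * K + a) div K = b" "(b' * K + a') div K = b'"
    using assms by auto
  then show "a = a' \<and> b = b'"
    using eq by auto
qed auto

text \<open>Crossing depends only on the block \<open>j\<close>, not on the position
  \<open>r\<close> in it: a coordinate in block \<open>j\<close> is at least \<open>i * K\<close> if
  \<open>i \<le> j\<close> and at most \<open>i * K - 1\<close> otherwise, so it avoids the overlap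
  zone around \<open>i * K - 1/2\<close>.\<close>

lemma of_nat_mem_span_ivl:
  assumes "i < K" "j < K" "r < K"
  shows "real (j * K + r) \<in> span_ivl K s i \<longleftrightarrow> (if s then i \<le> j else j < i)"
proof -
  have le: "(j + 1) * K \<le> K * K"
    using assms by (intro mult_right_mono) auto
  have "real (j * K + r) \<le> real (K * K)"
    using le assms by (intro of_nat_mono) (auto simp del: mult_le_cancel2)
  moreover have "real (i * K) \<le> real (j * K + r)" if "i \<le> j"
    using that by (intro of_nat_mono) (simp add: trans_le_add1)
  moreover have "real (j * K + r) + 1 \<le> real (i * K)" if "j < i"
  proof -
    have "(j + 1) * K \<le> i * K"
      using that by (intro mult_right_mono) auto
    then have "j * K + r + 1 \<le> i * K"
      using assms by (simp del: mult_le_cancel2)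
    then show ?thesis
      by (metis of_nat_1 of_nat_add of_nat_le_iff)
  qed
  moreover have "0 \<le> real (j * K + r)"
    by (rule of_nat_0_le_iff)
  ultimately show ?thesis
    unfolding span_ivl_def by (cases "i \<le> j") (auto simp del: of_nat_add of_nat_mult)
qed

lemma span_ivl_overlap:
  assumes "x \<in> span_ivl K True i" "x \<in> span_ivl K False i"
  shows "x \<notin> \<int>"
proof
  assume "x \<in> \<int>"
  then obtain z where z: "x = of_int z"
    by (auto elim: Ints_cases)
  have "int (i * K) - 1 < z" "z < int (i * K)"
    using assms z unfolding span_ivl_def by (simp_all del: of_nat_mult)
  then show False
    by linarith
qed

lemma span_ivl_overlap_nonempty:
  assumes "i < K"
  shows "real (i * K) - 1/2 \<in> span_ivl K True i \<inter> span_ivl K False i"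
proof -
  have "real (i * K) \<le> real (K * K)"
    using assms by (intro of_nat_mono mult_right_mono) auto
  moreover have "0 \<le> real (i * K)"
    by (rule of_nat_0_le_iff)
  ultimately show ?thesis
    unfolding span_ivl_def by (simp del: of_nat_mult mult_le_cancel2 of_nat_le_iff)
qed

lemma span_ivl_inject:
  assumes "i < K" "span_ivl K s i = span_ivl K t i"
  shows "s = t"
proof (rule ccontr)
  assume "s \<noteq> t"
  then have "span_ivl K True i = span_ivl K False i"
    using assms(2) by (cases s; cases t) auto
  \<comment> \<open>The first line of block \<open>i\<close> tells the two pieces apart; the summand
    \<open>0\<close> gives it the shape \<open>j * K + r\<close>.\<close>
  moreover have "real (i * K + 0) \<in> span_ivl K True i" "real (i * K + 0) \<notin> span_ivl K False i"
    using assms(1) by (subst of_nat_mem_span_ivl; simp)+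
  ultimately show False
    by simp
qed

lemma span_ivl_nonempty: "i < K \<Longrightarrow> span_ivl K s i \<noteq> {}"
  using span_ivl_overlap_nonempty[of i K] by (cases s) auto

section \<open>Distinctness, crossings and number of segments\<close>

lemma inj_on_hseg: "inj_on (\<lambda>(s, c). hseg K s c) (UNIV \<times> cells K)"
proof (rule inj_onI, clarify)
  fix s a b t a' b'
  assume c: "(a, b) \<in> cells K" "(a', b') \<in> cells K" and eq: "hseg K s (a, b) = hseg K t (a', b')"
  then have lt: "a < K" "a' < K"
    by (auto simp: cells_def)
  have "real (b * K + a) = real (b' * K + a')" and sp: "span_ivl K s a = span_ivl K t a'"
    using eq span_ivl_nonempty lt by (simp_all add: hseg_def times_eq_iff del: of_nat_add of_nat_mult)
  then have "a = a'" "b = b'"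
    using lt by (simp_all only: of_nat_eq_iff mult_add_eq_mult_add_iff)
  then show "s = t \<and> (a, b) = (a', b')"
    using span_ivl_inject sp lt by auto
qed

text \<open>Reflection in the diagonal transfers facts about horizontal segments to vertical
  ones.\<close>

lemma vseg_eq_swap_hseg: "vseg K s c = prod.swap ` hseg K s (prod.swap c)"
  unfolding vseg_def hseg_def by (auto simp: image_iff)

lemma swap_mem_cells [simp]: "prod.swap c \<in> cells K \<longleftrightarrow> c \<in> cells K"
  by (cases c) (auto simp: cells_def)

lemma inj_on_vseg: "inj_on (\<lambda>(s, c). vseg K s c) (UNIV \<times> cells K)"
proof (rule inj_onI)
  fix p q :: "bool \<times> nat \<times> nat"
  assume pq: "p \<in> UNIV \<times> cells K" "q \<in> UNIV \<times> cells K"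
    and eq: "(case p of (s, c) \<Rightarrow> vseg K s c) = (case q of (s, c) \<Rightarrow> vseg K s c)"
  obtain s c t d where st: "p = (s, c)" "q = (t, d)"
    by (metis surj_pair)
  have "hseg K s (prod.swap c) = hseg K t (prod.swap d)"
    using eq st by (simp add: vseg_eq_swap_hseg inj_image_eq_iff)
  then have "(s, prod.swap c) = (t, prod.swap d)"
    using pq st by (intro inj_onD[OF inj_on_hseg[of K]]) auto
  then show "p = q"
    using st by (metis Pair_inject swap_swap)
qed

text \<open>The common point is where the two supporting lines meet. Equality \<open>a = a'\<close>
  or \<open>b = b'\<close> counts as crossing exactly for direction \<open>True\<close>.\<close>

lemma hseg_int_vseg_nonempty:
  assumes "(a, b) \<in> cells K" "(a', b') \<in> cells K"
    and "if s then a \<le> a' else a' < a" "if t then b' \<le> b else b < b'"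
  shows "hseg K s (a, b) \<inter> vseg K t (a', b') \<noteq> {}"
proof -
  have "real (a' * K + b') \<in> span_ivl K s a" "real (b * K + a) \<in> span_ivl K t b'"
    using assms by (simp_all only: of_nat_mem_span_ivl cells_def mem_Sigma_iff lessThan_iff)
  then have "(real (a' * K + b'), real (b * K + a)) \<in> hseg K s (a, b) \<inter> vseg K t (a', b')"
    unfolding hseg_def vseg_def by simp
  then show ?thesis
    by blast
qed

lemma hseg_neq_vseg:
  assumes "c \<in> cells K"
  shows "hseg K s c \<noteq> vseg K t d"
proof
  assume eq: "hseg K s c = vseg K t d"
  obtain u v where uv: "u < v" "span_ivl K s (fst c) = {u..v}"
    using assms span_ivl_eq[of "fst c" K s] by (auto simp: cells_def)
  then have "(u, real (snd c * K + fst c)) \<in> hseg K s c" "(v, real (snd c * K + fst c)) \<in> hseg K s c"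
    by (auto simp: hseg_def)
  then have "u = v"
    unfolding eq by (auto simp: vseg_def)
  then show False
    using uv by simp
qed

lemma hsegs_disjoint_vsegs: "hsegs K \<inter> vsegs K = {}"
  unfolding hsegs_def vsegs_def using hseg_neq_vseg by fastforce

lemma finite_cells [simp]: "finite (cells K)"
  by (simp add: cells_def)

lemma card_cells: "card (cells K) = K\<^sup>2"
  by (simp add: cells_def power2_eq_square)

lemma finite_hsegs [simp]: "finite (hsegs K)"
  by (simp add: hsegs_def)

lemma finite_vsegs [simp]: "finite (vsegs K)"
  by (simp add: vsegs_def)

lemma card_segs: "card (hsegs K \<union> vsegs K) = 4 * K\<^sup>2"
proof -
  have "card (hsegs K) = 2 * K\<^sup>2" "card (vsegs K) = 2 * K\<^sup>2"
    unfolding hsegs_def vsegs_def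
    by (simp_all add: card_image inj_on_hseg inj_on_vseg card_cartesian_product card_cells)
  then show ?thesis
    by (simp add: card_Un_disjoint hsegs_disjoint_vsegs)
qed

section \<open>Points lying on several segments\<close>

lemma hseg_same_line:
  assumes "c \<in> cells K" "d \<in> cells K" "p \<in> hseg K s c" "p \<in> hseg K t d"
  shows "c = d"
proof -
  have "real (snd c * K + fst c) = real (snd d * K + fst d)"
    using assms(3,4) by (auto simp: hseg_def)
  then have "snd c * K + fst c = snd d * K + fst d"
    by (simp only: of_nat_eq_iff)
  then show ?thesis
    using assms(1,2) mult_add_eq_mult_add_iff[of "fst c" K "fst d" "snd c" "snd d"]
    by (auto simp: cells_def prod_eq_iff)
qed

text \<open>Distinct horizontal segments that meet are the two pieces of one line, so the point lies
  in their overlap.\<close>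

lemma hsegs_pair_point:
  assumes "A \<in> hsegs K" "B \<in> hsegs K" "A \<noteq> B" "p \<in> A" "p \<in> B"
  shows "fst p \<notin> \<int>"
proof -
  obtain s c t d where c: "c \<in> cells K" "A = hseg K s c" and d: "d \<in> cells K" "B = hseg K t d"
    using assms(1,2) unfolding hsegs_def by auto
  then have "c = d"
    using hseg_same_line assms by metis
  have "s \<noteq> t"
  proof
    assume "s = t"
    with \<open>c = d\<close> show False
      using c(2) d(2) assms(3) by simp
  qed
  then have "p \<in> hseg K True c" "p \<in> hseg K False c"
    using \<open>c = d\<close> c d assms by (cases s; cases t; simp; blast)+
  then show ?thesis
    using span_ivl_overlap unfolding hseg_def by auto
qed

text \<open>All three lie on the line of a single cell, which carries only two segments.\<close>

lemma hsegs_no_triple: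
  assumes "A \<in> hsegs K" "B \<in> hsegs K" "C \<in> hsegs K" "p \<in> A" "p \<in> B" "p \<in> C"
  shows "A = B \<or> A = C \<or> B = C"
proof -
  obtain s c t d u e where c: "c \<in> cells K" "A = hseg K s c" and d: "d \<in> cells K" "B = hseg K t d"
    and e: "e \<in> cells K" "C = hseg K u e"
    using assms(1-3) unfolding hsegs_def by auto
  then have "c = d" "c = e"
    using hseg_same_line assms by metis+
  then show ?thesis
    using c d e by (cases s; cases t; cases u) auto
qed

lemma mem_vsegs_iff: "A \<in> vsegs K \<longleftrightarrow> prod.swap ` A \<in> hsegs K"
proof
  assume "A \<in> vsegs K"
  then obtain s c where "c \<in> cells K" "A = vseg K s c"
    by (auto simp: vsegs_def)
  then have "prod.swap ` A = hseg K s (prod.swap c)" "prod.swap c \<in> cells K"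
    by (simp_all add: vseg_eq_swap_hseg image_comp)
  then show "prod.swap ` A \<in> hsegs K"
    unfolding hsegs_def by force
next
  assume "prod.swap ` A \<in> hsegs K"
  then obtain s c where c: "c \<in> cells K" "prod.swap ` A = hseg K s c"
    by (auto simp: hsegs_def)
  then have "prod.swap ` prod.swap ` A = vseg K s (prod.swap c)"
    by (simp add: vseg_eq_swap_hseg)
  moreover have "prod.swap ` prod.swap ` A = A"
    by (simp only: image_comp swap_comp_swap image_id id_apply)
  ultimately have "A = vseg K s (prod.swap c)" "prod.swap c \<in> cells K"
    using c by simp_all
  then show "A \<in> vsegs K"
    unfolding vsegs_def by force
qed

lemma swap_image_eq_iff: "prod.swap ` A = prod.swap ` B \<longleftrightarrow> A = B"
  by (simp add: inj_image_eq_iff)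

lemma vsegs_pair_point:
  assumes "A \<in> vsegs K" "B \<in> vsegs K" "A \<noteq> B" "p \<in> A" "p \<in> B"
  shows "snd p \<notin> \<int>"
  using hsegs_pair_point[of "prod.swap ` A" K "prod.swap ` B" "prod.swap p"] assms
  by (simp add: mem_vsegs_iff swap_image_eq_iff)

lemma vsegs_no_triple:
  assumes "A \<in> vsegs K" "B \<in> vsegs K" "C \<in> vsegs K" "p \<in> A" "p \<in> B" "p \<in> C"
  shows "A = B \<or> A = C \<or> B = C"
  using hsegs_no_triple[of "prod.swap ` A" K "prod.swap ` B" "prod.swap ` C" "prod.swap p"] assms
  by (simp add: mem_vsegs_iff swap_image_eq_iff)

lemma hsegs_snd_Ints: "A \<in> hsegs K \<Longrightarrow> p \<in> A \<Longrightarrow> snd p \<in> \<int>"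
  unfolding hsegs_def hseg_def by auto

lemma vsegs_fst_Ints: "A \<in> vsegs K \<Longrightarrow> p \<in> A \<Longrightarrow> fst p \<in> \<int>"
  unfolding vsegs_def vseg_def by auto

text \<open>Two of three segments are parallel. If the third is parallel too, they share a line with
  only two segments. Otherwise the third forces an integer coordinate where the overlap of the first
  two has none.\<close>

lemma segs_no_triple:
  assumes "A \<in> hsegs K \<union> vsegs K" "B \<in> hsegs K \<union> vsegs K" "C \<in> hsegs K \<union> vsegs K"
    and "A \<noteq> B" "A \<noteq> C" "B \<noteq> C"
  shows "A \<inter> B \<inter> C = {}"
proof (rule ccontr)
  assume "A \<inter> B \<inter> C \<noteq> {}"
  then obtain p where "p \<in> A" "p \<in> B" "p \<in> C"
    by blast
  then show False
    using assms hsegs_no_triple[of A K B C p] vsegs_no_triple[of A K B C p]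
      hsegs_pair_point[of _ K _ p] vsegs_pair_point[of _ K _ p]
      hsegs_snd_Ints[of _ K p] vsegs_fst_Ints[of _ K p]
    by (metis Un_iff)
qed

lemma intersection_graph_mem_G_seg:
  assumes "S \<subseteq> hsegs K \<union> vsegs K"
  shows "intersection_graph S \<in> \<G>\<^sub>s\<^sub>e\<^sub>g"
proof -
  have "finite S"
    using assms by (rule finite_subset) simp
  moreover have "horizontal_segment A \<or> vertical_segment A" if "A \<in> S" for A
  proof -
    have "A \<in> hsegs K \<union> vsegs K"
      using assms that by blast
    then show ?thesis
      unfolding hsegs_def vsegs_def using horizontal_segment_hseg vertical_segment_vseg by auto
  qed
  moreover have "A \<inter> B \<inter> C = {}"
    if "A \<in> S" "B \<in> S" "C \<in> S" "A \<noteq> B \<and> A \<noteq> C \<and> B \<noteq> C" for A B C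
    using that assms by (intro segs_no_triple[of A K B C]) auto
  ultimately show ?thesis
    unfolding G_seg_def by blast
qed

section \<open>Size of disjoint subfamilies\<close>

text \<open>Of the two coordinates \<open>a + b\<close> and \<open>a - b\<close>, one is injective on a monotone chain.\<close>

lemma card_contributing_both_le:
  assumes "T \<subseteq> cells K"
    and disj: "\<And>c d. c \<in> T \<Longrightarrow> d \<in> T \<Longrightarrow> hseg K s c \<inter> vseg K t d = {}"
  shows "card T \<le> 2 * K"
proof -
  \<comment> \<open>Equal directions give an increasing chain, opposite ones a decreasing chain with
    respect to reversed \<open>b\<close>: \<open>a + b\<close> or \<open>a - b\<close> is injective
    respectively. The latter is shifted by \<open>K - 1\<close> to stay in the naturals; on cells
    both are at most \<open>2 * K - 2\<close>.\<close>
  define f where "f = (\<lambda>(a, b). if s = t then a + b else a + (K - b - 1))"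
  have no: "\<not> ((if s then a \<le> a' else a' < a) \<and> (if t then b' \<le> b else b < b'))"
    if "(a, b) \<in> T" "(a', b') \<in> T" for a b a' b'
    using hseg_int_vseg_nonempty[of a b K a' b' s t] disj[OF that] that assms(1) by blast
  have "inj_on f T"
  proof (rule inj_onI, clarify)
    fix a b a' b'
    assume T: "(a, b) \<in> T" "(a', b') \<in> T" and eq: "f (a, b) = f (a', b')"
    then have "b < K" "b' < K"
      using assms(1) by (auto simp: cells_def)
    then show "a = a' \<and> b = b'"
      using no[OF T] no[OF T(2,1)] eq unfolding f_def
      by (cases s; cases t; simp; linarith)
  qed
  moreover have "f ` T \<subseteq> {..<2 * K}"
    using assms(1) by (fastforce simp: f_def cells_def)
  ultimately have "card T \<le> card {..<2 * K}"
    by (intro card_inj_on_le) auto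
  then show ?thesis
    by simp
qed

text \<open>The two pieces of a line meet, so \<open>I\<close> contains at most one of them. The
  abstract \<open>f\<close> serves both \<open>hseg\<close> and \<open>vseg\<close>.\<close>

lemma card_segs_of_lines_le:
  fixes f :: "bool \<Rightarrow> 'c \<Rightarrow> 'a set"
  assumes "finite C"
    and meet: "\<And>c. c \<in> C \<Longrightarrow> f True c \<inter> f False c \<noteq> {}"
    and neq: "\<And>c. c \<in> C \<Longrightarrow> f True c \<noteq> f False c"
    and disj: "\<And>A B. A \<in> I \<Longrightarrow> B \<in> I \<Longrightarrow> A \<noteq> B \<Longrightarrow> A \<inter> B = {}"
  shows "card (I \<inter> (\<lambda>(s, c). f s c) ` (UNIV \<times> C)) \<le> card {c \<in> C. \<exists>s. f s c \<in> I}"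
proof (rule surj_card_le)
  show "finite {c \<in> C. \<exists>s. f s c \<in> I}"
    using assms(1) by simp
  show "I \<inter> (\<lambda>(s, c). f s c) ` (UNIV \<times> C)
      \<subseteq> (\<lambda>c. f (f True c \<in> I) c) ` {c \<in> C. \<exists>s. f s c \<in> I}"
  proof clarify
    fix s c
    assume c: "f s c \<in> I" "c \<in> C"
    then have "f s c = f (f True c \<in> I) c"
      using meet[of c] neq[of c] disj[of "f True c" "f False c"]
      by (cases s; cases "f True c \<in> I") auto
    then show "f s c \<in> (\<lambda>c. f (f True c \<in> I) c) ` {c \<in> C. \<exists>s. f s c \<in> I}"
      using c by blast
  qed
qed

text \<open>Inclusion-exclusion on the cells contributing a horizontal and those contributing a
  vertical segment: the union has at most all \<open>K\<^sup>2\<close> cells, the intersection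
  splits into four direction classes of size at most \<open>2 * K\<close>.\<close>

lemma card_disjoint_segs_le:
  assumes sub: "I \<subseteq> hsegs K \<union> vsegs K"
    and disj: "\<And>A B. A \<in> I \<Longrightarrow> B \<in> I \<Longrightarrow> A \<noteq> B \<Longrightarrow> A \<inter> B = {}"
  shows "card I \<le> K\<^sup>2 + 8 * K"
proof -
  define CH where "CH = {c \<in> cells K. \<exists>s. hseg K s c \<in> I}"
  define CV where "CV = {c \<in> cells K. \<exists>s. vseg K s c \<in> I}"
  define T where "T = (\<lambda>(s, t). {c \<in> cells K. hseg K s c \<in> I \<and> vseg K t c \<in> I})"
  have meet: "hseg K True c \<inter> hseg K False c \<noteq> {}" "vseg K True c \<inter> vseg K False c \<noteq> {}"
    if "c \<in> cells K" for c
    using that span_ivl_overlap_nonempty[of "fst c" K] span_ivl_overlap_nonempty[of "snd c" K]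
    by (force simp: hseg_def vseg_def cells_def)+
  have neq: "hseg K True c \<noteq> hseg K False c" "vseg K True c \<noteq> vseg K False c"
    if "c \<in> cells K" for c
    using that inj_onD[OF inj_on_hseg[of K], of "(True, c)" "(False, c)"]
      inj_onD[OF inj_on_vseg[of K], of "(True, c)" "(False, c)"] by auto
  have H: "card (I \<inter> hsegs K) \<le> card CH"
    unfolding hsegs_def CH_def by (rule card_segs_of_lines_le) (simp_all add: meet neq disj)
  have V: "card (I \<inter> vsegs K) \<le> card CV"
    unfolding vsegs_def CV_def by (rule card_segs_of_lines_le) (simp_all add: meet neq disj)
  have fin: "finite CH" "finite CV"
    unfolding CH_def CV_def by simp_all
  have T_le: "card (T p) \<le> 2 * K" for p
  proof (cases p)
    case (Pair s t)
    show ?thesis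
      unfolding T_def Pair prod.case
    proof (rule card_contributing_both_le[where s = s and t = t])
      show "hseg K s c \<inter> vseg K t d = {}"
        if "c \<in> {c \<in> cells K. hseg K s c \<in> I \<and> vseg K t c \<in> I}"
          "d \<in> {c \<in> cells K. hseg K s c \<in> I \<and> vseg K t c \<in> I}" for c d
        using that by (intro disj hseg_neq_vseg) auto
    qed auto
  qed
  have "CH \<inter> CV \<subseteq> (\<Union>p\<in>UNIV. T p)"
    unfolding CH_def CV_def T_def by auto
  then have "card (CH \<inter> CV) \<le> card (\<Union>p\<in>UNIV. T p)"
    by (rule card_mono[rotated]) (auto simp: T_def)
  also have "\<dots> \<le> (\<Sum>p\<in>UNIV. card (T p))"
    by (rule card_UN_le) simp
  also have "\<dots> \<le> (\<Sum>p\<in>(UNIV :: (bool \<times> bool) set). 2 * K)"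
    by (intro sum_mono T_le)
  also have "\<dots> = 8 * K"
    by (simp add: card_UNIV_bool flip: UNIV_Times_UNIV)
  finally have both: "card (CH \<inter> CV) \<le> 8 * K" .
  have "card (CH \<union> CV) \<le> card (cells K)"
    by (rule card_mono) (auto simp: CH_def CV_def)
  then have any: "card (CH \<union> CV) \<le> K\<^sup>2"
    by (simp add: card_cells)
  have "I = (I \<inter> hsegs K) \<union> (I \<inter> vsegs K)"
    using sub by auto
  then have "card I \<le> card (I \<inter> hsegs K) + card (I \<inter> vsegs K)"
    by (metis card_Un_le)
  also have "\<dots> \<le> card CH + card CV"
    using H V by linarith
  also have "\<dots> = card (CH \<union> CV) + card (CH \<inter> CV)"
    using fin by (rule card_Un_Int)
  also have "\<dots> \<le> K\<^sup>2 + 8 * K"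
    using both any by linarith
  finally show ?thesis .
qed

section \<open>Independence number and choice of the array size\<close>

lemma independence_number_le:
  assumes "finite (pverts G)" "\<And>I. independent_set G I \<Longrightarrow> card I \<le> m"
  shows "\<alpha> G \<le> m"
proof -
  have "{I. independent_set G I} \<subseteq> Pow (pverts G)"
    by (auto simp: independent_set_def)
  then have "finite {I. independent_set G I}"
    using assms(1) finite_subset by blast
  then have "finite {card I | I. independent_set G I}"
    by (simp add: setcompr_eq_image)
  moreover have "independent_set G {}"
    by (simp add: independent_set_def)
  ultimately show ?thesis
    using assms(2) unfolding independence_number_def by (subst Max_le_iff) auto
qed

text \<open>Independent means pairwise disjoint here. Allowing any subfamily lets the order of the
  graph be adjusted to an arbitrary \<open>n\<close>.\<close>

lemma independence_number_segs_le:
  assumes "S \<subseteq> hsegs K \<union> vsegs K"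
  shows "\<alpha> (intersection_graph S) \<le> K\<^sup>2 + 8 * K"
proof (rule independence_number_le)
  show "finite (pverts (intersection_graph S))"
    using assms by (auto simp: intersection_graph_def intro: finite_subset)
  fix I
  assume I: "independent_set (intersection_graph S) I"
  then have "I \<subseteq> S"
    by (auto simp: independent_set_def intersection_graph_def)
  moreover have "A \<inter> B = {}" if "A \<in> I" "B \<in> I" "A \<noteq> B" for A B
    using I that \<open>I \<subseteq> S\<close> unfolding independent_set_def intersection_graph_def by auto
  ultimately show "card I \<le> K\<^sup>2 + 8 * K"
    using assms by (intro card_disjoint_segs_le) auto
qed

theorem theorem2:
  shows "\<exists>c\<^sub>2 :: real. \<forall>n :: nat. \<exists>G \<in> \<G>\<^sub>s\<^sub>e\<^sub>g.
    card (pverts G) = n \<and> real (\<alpha> G) \<le> real n / 4 + c\<^sub>2 * sqrt (real n)"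
\<comment> \<open>With \<open>x = sqrt n\<close> and \<open>K < x / 2 + 1\<close>,
  \<open>K\<^sup>2 + 8 * K\<close> is at most \<open>n / 4 + 5 * x + 9\<close>, and
  \<open>9 \<le> 9 * x\<close> once \<open>n\<close> is positive.\<close>
proof (intro exI[of _ 14] allI)
  fix n :: nat
  define x where "x = sqrt (real n)"
  \<comment> \<open>The least \<open>K\<close> with \<open>n \<le> 4 * K\<^sup>2\<close>.\<close>
  define K where "K = nat \<lceil>x / 2\<rceil>"
  have x: "0 \<le> x" "x\<^sup>2 = real n"
    by (simp_all add: x_def)
  have K: "x / 2 \<le> real K" "real K < x / 2 + 1"
    using x(1) unfolding K_def by linarith+
  have "(x / 2)\<^sup>2 \<le> (real K)\<^sup>2"
    using K(1) x(1) by (intro power_mono) auto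
  then have "real n \<le> real (4 * K\<^sup>2)"
    using x(2) by (simp add: power_divide)
  then have "n \<le> card (hsegs K \<union> vsegs K)"
    by (simp only: of_nat_le_iff card_segs)
  then obtain S where S: "S \<subseteq> hsegs K \<union> vsegs K" "card S = n"
    by (meson obtain_subset_with_card_n)
  have "real (\<alpha> (intersection_graph S)) \<le> real (K\<^sup>2 + 8 * K)"
    using independence_number_segs_le[OF S(1)] by (simp only: of_nat_le_iff)
  also have "\<dots> \<le> real n / 4 + 14 * x"
  \<comment> \<open>For \<open>n = 0\<close> the term \<open>x\<close> vanishes and cannot absorb
    the constant \<open>9\<close>, but then \<open>K = 0\<close>.\<close>
  proof (cases "n = 0")
    case True
    then show ?thesis
      by (simp add: K_def x_def)
  next
    case False
    then have "1 \<le> x"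
      by (simp add: x_def)
    have "(real K)\<^sup>2 \<le> (x / 2 + 1)\<^sup>2"
      using K(2) by (intro power_mono) auto
    also have "\<dots> = real n / 4 + x + 1"
      using x(2) by (simp add: power2_eq_square algebra_simps)
    finally show ?thesis
      using K(2) \<open>1 \<le> x\<close> by simp
  qed
  finally have "real (\<alpha> (intersection_graph S)) \<le> real n / 4 + 14 * sqrt (real n)"
    by (simp add: x_def)
  moreover have "card (pverts (intersection_graph S)) = n"
    using S(2) by (simp add: intersection_graph_def)
  ultimately show "\<exists>G \<in> \<G>\<^sub>s\<^sub>e\<^sub>g.
    card (pverts G) = n \<and> real (\<alpha> G) \<le> real n / 4 + 14 * sqrt (real n)"
    using intersection_graph_mem_G_seg[OF S(1)] by blast
qed

end
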